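(* Let $X$ be a real Banach space and $N_X$ a net in $X$. Then $\mathrm{Lip}_0(N_X)$ contains a complemented subspace that is linearly isomorphic to $\mathrm{Lip}_0(X)$.
   Context: A subset $N$ of a metric space $M$ is a net in $M$ if there exist $\varepsilon,\delta>0$ such that for every $x\in M$ there is $y\in N$ with $d(x,y)\leq\varepsilon$, and $d(x,y)\geq\delta$ for all $x\neq y$ in $N$. Banach spaces carry the norm metric and subsets carry the restricted metric. For a metric space $M$ with a chosen base point $0\in M$, $\mathrm{Lip}_0(M)$ is the Banach space of Lipschitz functions $f:M\to\mathbb{R}$ with $f(0)=0$, normed by the best Lipschitz constant; up to linear isometry it does not depend on the base point. *)

theory Defs
  imports "HOL-Analysis.Analysis" "HOL-Library.Function_Algebras"
begin

section \<open>Real-valued functions as a real vector space\<close>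

instantiation "fun" :: (type, real_vector) real_vector
begin

definition scaleR_fun_def: "c *\<^sub>R f = (\<lambda>x. c *\<^sub>R f x)"

instance
  by standard (simp_all add: scaleR_fun_def fun_eq_iff scaleR_add_right scaleR_add_left)

end

lemma scaleR_fun_apply [simp]: "(c *\<^sub>R f) x = c *\<^sub>R f x"
  by (simp add: scaleR_fun_def)

section \<open>Nets\<close>

definition metric_net :: "'a::metric_space set \<Rightarrow> 'a set \<Rightarrow> bool" where
  "metric_net N M \<longleftrightarrow> N \<subseteq> M \<and>
     (\<exists>\<epsilon>>0. \<exists>\<delta>>0. (\<forall>x\<in>M. \<exists>y\<in>N. dist x y \<le> \<epsilon>) \<and>
       (\<forall>x\<in>N. \<forall>y\<in>N. x \<noteq> y \<longrightarrow> dist x y \<ge> \<delta>))"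

section \<open>Normed spaces on a carrier\<close>

text \<open>A normed space is given by a linear subspace \<open>V\<close> of a real vector space
  together with a function \<open>nV\<close>, of which only the values on \<open>V\<close> matter.
  Maps between such spaces matter only on the carrier as well.\<close>

definition bounded_linear_between ::
  "'v::real_vector set \<Rightarrow> ('v \<Rightarrow> real) \<Rightarrow> 'w::real_vector set \<Rightarrow> ('w \<Rightarrow> real) \<Rightarrow> ('v \<Rightarrow> 'w) \<Rightarrow> bool" where
  "bounded_linear_between V nV W nW T \<longleftrightarrow>
     (\<forall>f\<in>V. T f \<in> W) \<and>
     (\<forall>f\<in>V. \<forall>g\<in>V. T (f + g) = T f + T g) \<and>
     (\<forall>c. \<forall>f\<in>V. T (c *\<^sub>R f) = c *\<^sub>R T f) \<and>
     (\<exists>K. \<forall>f\<in>V. nW (T f) \<le> K * nV f)"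

definition linearly_isomorphic ::
  "'v::real_vector set \<Rightarrow> ('v \<Rightarrow> real) \<Rightarrow> 'w::real_vector set \<Rightarrow> ('w \<Rightarrow> real) \<Rightarrow> bool" where
  "linearly_isomorphic V nV W nW \<longleftrightarrow>
     (\<exists>T. bij_betw T V W \<and> bounded_linear_between V nV W nW T \<and>
       bounded_linear_between W nW V nV (inv_into V T))"

definition norm_closed_in :: "'v::real_vector set \<Rightarrow> 'v set \<Rightarrow> ('v \<Rightarrow> real) \<Rightarrow> bool" where
  "norm_closed_in Y V nV \<longleftrightarrow>
     (\<forall>s f. (\<forall>n. s n \<in> Y) \<and> f \<in> V \<and> (\<lambda>n. nV (s n - f)) \<longlonglongrightarrow> 0 \<longrightarrow> f \<in> Y)"

definition complemented_subspace :: "'v::real_vector set \<Rightarrow> 'v set \<Rightarrow> ('v \<Rightarrow> real) \<Rightarrow> bool" where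
  "complemented_subspace Y V nV \<longleftrightarrow>
     subspace Y \<and> Y \<subseteq> V \<and> norm_closed_in Y V nV \<and>
     (\<exists>P. bounded_linear_between V nV V nV P \<and> P ` V = Y \<and> (\<forall>f\<in>Y. P f = f))"

section \<open>Spaces of Lipschitz functions\<close>

text \<open>\<open>lip0 M p\<close> is the space of Lipschitz functions on the metric space \<open>M\<close> (with the metric
  restricted from the ambient type) with base point \<open>p\<close>. A function on \<open>M\<close> is represented by its
  extension by zero to the whole type; the Lipschitz condition concerns \<open>M\<close> only.\<close>

definition lip0 :: "'a::metric_space set \<Rightarrow> 'a \<Rightarrow> ('a \<Rightarrow> real) set" where
  "lip0 M p = {f. (\<exists>C. C-lipschitz_on M f) \<and> f p = 0 \<and> (\<forall>x. x \<notin> M \<longrightarrow> f x = 0)}"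

definition lip_norm :: "'a::metric_space set \<Rightarrow> ('a \<Rightarrow> real) \<Rightarrow> real" where
  "lip_norm M f = Inf {C. C-lipschitz_on M f}"

lemma lip_norm_le: "C-lipschitz_on M f \<Longrightarrow> lip_norm M f \<le> C"
  unfolding lip_norm_def
  by (rule cInf_lower) (auto intro!: bdd_belowI[of _ 0] simp: lipschitz_on_nonneg)

lemma lip_norm_nonneg: "f \<in> lip0 M p \<Longrightarrow> 0 \<le> lip_norm M f"
  unfolding lip_norm_def lip0_def
  by (rule cInf_greatest) (auto simp: lipschitz_on_nonneg)

lemma lip_norm_lipschitz:
  assumes "f \<in> lip0 M p"
  shows "(lip_norm M f)-lipschitz_on M f"
proof (rule lipschitz_onI)
  show "0 \<le> lip_norm M f" using assms by (rule lip_norm_nonneg)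
  fix x y assume xy: "x \<in> M" "y \<in> M"
  show "dist (f x) (f y) \<le> lip_norm M f * dist x y"
  proof (cases "x = y")
    case False
    then have d: "0 < dist x y" by simp
    have "dist (f x) (f y) / dist x y \<le> lip_norm M f"
      unfolding lip_norm_def
    proof (rule cInf_greatest)
      show "{C. C-lipschitz_on M f} \<noteq> {}" using assms by (auto simp: lip0_def)
      fix C assume "C \<in> {C. C-lipschitz_on M f}"
      then have "dist (f x) (f y) \<le> C * dist x y" using xy by (auto dest: lipschitz_onD)
      then show "dist (f x) (f y) / dist x y \<le> C" using d by (simp add: divide_le_eq)
    qed
    then show ?thesis using d by (simp add: divide_le_eq)
  qed simp
qed

lemma lip_norm_add_lipschitz:
  assumes "f \<in> lip0 M p" "g \<in> lip0 M p"
  shows "(lip_norm M f + lip_norm M g)-lipschitz_on M (f + g)"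
  using lipschitz_on_add[OF lip_norm_lipschitz[OF assms(1)] lip_norm_lipschitz[OF assms(2)]]
  by (simp add: plus_fun_def)

lemma lip_norm_scaleR_lipschitz:
  assumes "f \<in> lip0 M p"
  shows "(\<bar>c\<bar> * lip_norm M f)-lipschitz_on M (c *\<^sub>R f)"
  using lipschitz_on_cmult_real[OF lip_norm_lipschitz[OF assms], of c]
  by (simp add: scaleR_fun_def)

lemma subspace_lip0: "subspace (lip0 M p)"
proof (rule subspaceI)
  have "0-lipschitz_on M (0 :: 'a \<Rightarrow> real)" by (auto intro: lipschitz_onI)
  then show "0 \<in> lip0 M p" unfolding lip0_def by auto
  show "f + g \<in> lip0 M p" if "f \<in> lip0 M p" "g \<in> lip0 M p" for f g
    using lip_norm_add_lipschitz[OF that] that unfolding lip0_def by auto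
  show "c *\<^sub>R f \<in> lip0 M p" if "f \<in> lip0 M p" for c f
    using lip_norm_scaleR_lipschitz[OF that, of c] that unfolding lip0_def by auto
qed

lemma lip_norm_triangle:
  "f \<in> lip0 M p \<Longrightarrow> g \<in> lip0 M p \<Longrightarrow> lip_norm M (f + g) \<le> lip_norm M f + lip_norm M g"
  by (rule lip_norm_le) (rule lip_norm_add_lipschitz)

lemma lip_norm_scaleR:
  assumes f: "f \<in> lip0 M p"
  shows "lip_norm M (c *\<^sub>R f) = \<bar>c\<bar> * lip_norm M f"
proof -
  have le: "lip_norm M (a *\<^sub>R g) \<le> \<bar>a\<bar> * lip_norm M g" if "g \<in> lip0 M p" for a g
    using that by (intro lip_norm_le lip_norm_scaleR_lipschitz)
  have mem: "a *\<^sub>R f \<in> lip0 M p" for a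
    using subspace_lip0 f by (rule subspace_scale)
  show ?thesis
  proof (cases "c = 0")
    case True
    then show ?thesis using le[OF f, of 0] lip_norm_nonneg[OF mem[of 0]] by simp
  next
    case False
    then have "lip_norm M f \<le> \<bar>inverse c\<bar> * lip_norm M (c *\<^sub>R f)"
      using le[OF mem[of c], of "inverse c"] by simp
    then have "\<bar>c\<bar> * lip_norm M f \<le> lip_norm M (c *\<^sub>R f)"
      using False by (simp add: field_simps)
    then show ?thesis using le[OF f, of c] by simp
  qed
qed

lemma lip_norm_eq_0_iff:
  assumes f: "f \<in> lip0 M p" and p: "p \<in> M"
  shows "lip_norm M f = 0 \<longleftrightarrow> f = 0"
proof
  assume n: "lip_norm M f = 0"
  have "f x = 0" for x
  proof (cases "x \<in> M")
    case True
    then show ?thesis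
      using lipschitz_onD[OF lip_norm_lipschitz[OF f] True p] n f by (simp add: lip0_def)
  qed (use f in \<open>simp add: lip0_def\<close>)
  then show "f = 0" by (simp add: fun_eq_iff)
next
  assume "f = 0"
  then show "lip_norm M f = 0" using lip_norm_scaleR[OF f, of 0] by simp
qed

end

theory Submission
  imports Defs
begin

text \<open>
  Fix a unit vector \<open>e\<close> and the well separated balls with centres \<open>c n = 4 ^ (n + 1) e\<close> and radii
  \<open>2 * 4 ^ n\<close>. A Lipschitz function \<open>f\<close> on the whole space is dilated by the factor \<open>2 ^ n\<close>,
  transplanted to the \<open>n\<close>-th ball and cut off there; as the supports are disjoint, the sum \<open>T f\<close> over
  all \<open>n\<close> is Lipschitz, and it is restricted to the net. Conversely, a Lipschitz function \<open>g\<close> on the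
  net is read off near \<open>c n\<close> at scale \<open>2 ^ n\<close>, and the ultralimit over \<open>n\<close> of these blow-downs is a
  Lipschitz function \<open>S g\<close> on the whole space: the mesh of the net, seen at scale \<open>2 ^ n\<close>, tends
  to \<open>0\<close>. As \<open>4 ^ n / 2 ^ n\<close> tends to infinity, the cutoff is not seen in the limit, so \<open>S \<circ> T\<close> is
  the identity and \<open>T \<circ> S\<close> is a projection onto the range of \<open>T\<close>.
\<close>

section \<open>Limits along an ultrafilter\<close>

definition ultrafilter :: "'a filter \<Rightarrow> bool" where
  "ultrafilter U \<longleftrightarrow> U \<noteq> bot \<and> (\<forall>P. eventually P U \<or> eventually (\<lambda>x. \<not> P x) U)"

text \<open>Zorn's lemma for the proper filters below \<open>F\<close>, finer ones counting as
  larger: a minimal proper filter decides every predicate.\<close>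

lemma ultrafilter_exists:
  assumes "F \<noteq> bot"
  shows "\<exists>U. U \<le> F \<and> ultrafilter U"
proof -
  let ?A = "{G. G \<noteq> bot \<and> G \<le> F}"
  have "\<exists>U\<in>?A. \<forall>G\<in>?A. G \<le> U \<longrightarrow> G = U"
  proof (rule predicate_Zorn)
    show "partial_order_on ?A (relation_of (\<lambda>x y. y \<le> x) ?A)"
      by (rule partial_order_on_relation_ofI) auto
  next
    fix C assume C: "C \<in> Chains (relation_of (\<lambda>x y. y \<le> x) ?A)"
    then have sub: "C \<subseteq> ?A" and lin: "\<And>G H. G \<in> C \<Longrightarrow> H \<in> C \<Longrightarrow> G \<le> H \<or> H \<le> G"
      by (auto simp: Chains_def relation_of_def)
    show "\<exists>u\<in>?A. \<forall>a\<in>C. u \<le> a"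
    proof (cases "C = {}")
      case True
      then show ?thesis using assms by auto
    next
      case False
      \<comment> \<open>A chain is directed downwards, so whatever holds along \<open>Inf C\<close>
        already holds along a single member. As no member makes \<open>False\<close> eventual,
        \<open>Inf C\<close> is proper.\<close>
      have "eventually P (Inf C) \<longleftrightarrow> (\<exists>G\<in>C. eventually P G)" for P
        using False
      proof (rule eventually_Inf_base)
        fix G H assume "G \<in> C" "H \<in> C"
        then show "\<exists>x\<in>C. x \<le> inf G H"
          using lin[of G H] by (auto intro: bexI[of _ G] bexI[of _ H])
      qed
      then have "Inf C \<noteq> bot"
        using sub by (auto simp: trivial_limit_def)
      moreover have "Inf C \<le> F"
        using False sub by (auto intro: Inf_lower2)
      ultimately show ?thesis
        by (intro bexI[of _ "Inf C"]) (auto intro: Inf_lower)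
    qed
  qed
  then obtain U where U: "U \<noteq> bot" "U \<le> F"
    and min: "\<And>G. G \<noteq> bot \<Longrightarrow> G \<le> F \<Longrightarrow> G \<le> U \<Longrightarrow> G = U"
    by blast
  have "eventually P U" if "\<not> eventually (\<lambda>x. \<not> P x) U" for P
  proof -
    \<comment> \<open>Adjoining \<open>P\<close> keeps \<open>U\<close> proper because the negation
      is not eventual; minimality then says that \<open>P\<close> was there before.\<close>
    have "inf U (principal {x. P x}) \<noteq> bot"
      using that by (auto simp: trivial_limit_def eventually_inf_principal)
    then have "inf U (principal {x. P x}) = U"
      using U(2) by (intro min) (auto intro: le_infI1)
    moreover have "eventually P (inf U (principal {x. P x}))"
      by (simp add: eventually_inf_principal)
    ultimately show ?thesis
      by simp
  qed
  then show ?thesis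
    using U by (auto simp: ultrafilter_def)
qed

text \<open>Compactness provides a cluster point of the image filter. A neighbourhood that is not
  eventual would have an eventual complement, so the cluster point is a limit.\<close>

lemma ultrafilter_compact_limit:
  assumes U: "ultrafilter U" and K: "compact K" and ev: "eventually (\<lambda>x. s x \<in> K) U"
  shows "\<exists>l\<in>K. (s \<longlongrightarrow> l) U"
proof -
  have "filtermap s U \<noteq> bot"
    using U by (simp add: ultrafilter_def filtermap_bot_iff)
  then obtain l where l: "l \<in> K" "inf (nhds l) (filtermap s U) \<noteq> bot"
    using K ev unfolding compact_filter by (auto simp: eventually_filtermap)
  have "eventually P (filtermap s U)" if P: "eventually P (nhds l)" for P
  proof (rule ccontr)
    assume "\<not> eventually P (filtermap s U)"
    then have "eventually (\<lambda>x. \<not> P x) (filtermap s U)"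
      using U by (auto simp: ultrafilter_def eventually_filtermap)
    then have "eventually (\<lambda>x. False) (inf (nhds l) (filtermap s U))"
      using P unfolding eventually_inf by blast
    then show False
      using l(2) by (simp add: trivial_limit_def)
  qed
  then show ?thesis
    using l(1) by (auto simp: filterlim_def le_filter_def)
qed

text \<open>Makes the description \<open>Lim U s\<close> meaningful, so that limit laws apply to
  it.\<close>

lemma ultrafilter_Lim_bounded:
  fixes s :: "'b \<Rightarrow> real"
  assumes U: "ultrafilter U" and b: "\<And>n. \<bar>s n\<bar> \<le> B"
  shows "(s \<longlongrightarrow> Lim U s) U"
proof -
  have "eventually (\<lambda>x. s x \<in> {-B..B}) U"
    using b by (auto simp: abs_le_iff minus_le_iff)
  then obtain l where "(s \<longlongrightarrow> l) U"
    using ultrafilter_compact_limit[OF U compact_Icc] by blast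
  then show ?thesis
    using tendsto_Lim[of U s l] U by (simp add: ultrafilter_def)
qed

section \<open>Cutting off and gluing Lipschitz functions\<close>

definition bump :: "'a::metric_space \<Rightarrow> real \<Rightarrow> 'a \<Rightarrow> real" where
  "bump c r x = max 0 (min 1 (2 - dist x c / r))"

lemma bump_nonneg: "0 \<le> bump c r x"
  and bump_le_1: "bump c r x \<le> 1"
  by (auto simp: bump_def)

lemma bump_eq_1: "r > 0 \<Longrightarrow> dist x c \<le> r \<Longrightarrow> bump c r x = 1"
  by (simp add: bump_def min_def max_def field_simps)

lemma bump_eq_0: "r > 0 \<Longrightarrow> 2 * r \<le> dist x c \<Longrightarrow> bump c r x = 0"
  by (simp add: bump_def min_def max_def field_simps)

lemma bump_diff_le:
  assumes "r > 0"
  shows "\<bar>bump c r x - bump c r y\<bar> \<le> dist x y / r"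
proof -
  have "\<bar>bump c r x - bump c r y\<bar> \<le> \<bar>dist x c / r - dist y c / r\<bar>"
    by (auto simp: bump_def min_def max_def)
  also have "\<dots> = \<bar>dist x c - dist y c\<bar> / r"
    using assms by (simp flip: diff_divide_distrib)
  also have "\<dots> \<le> dist x y / r"
    using assms abs_dist_diff_le[of x c y] by (simp add: divide_right_mono dist_commute)
  finally show ?thesis .
qed

text \<open>Product rule: the cutoff has slope \<open>1 / r\<close>, but since
  \<open>f c = 0\<close>, \<open>f\<close> is at most \<open>2 * r * L\<close> where the cutoff
  lives. The radius cancels, so the constant is the same at all scales.\<close>

lemma lipschitz_on_bump_mult:
  fixes f :: "'a::metric_space \<Rightarrow> real"
  assumes r: "r > 0" and f: "L-lipschitz_on UNIV f" and fc: "f c = 0"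
  shows "(3 * L)-lipschitz_on UNIV (\<lambda>x. bump c r x * f x)"
proof (rule lipschitz_onI)
  have L: "0 \<le> L"
    using f by (rule lipschitz_on_nonneg)
  then show "0 \<le> 3 * L"
    by simp
  have f_diff: "\<bar>f x - f y\<bar> \<le> L * dist x y" for x y
    using lipschitz_onD[OF f, of x y] by (simp add: dist_real_def)
  \<comment> \<open>The splitting evaluates \<open>f\<close> alone only at \<open>x\<close>, so it
    is enough that one of the two points lies in the ball; the terms contribute \<open>2 * L\<close>
    and \<open>L\<close>.\<close>
  have near: "\<bar>bump c r x * f x - bump c r y * f y\<bar> \<le> 3 * L * dist x y"
    if x: "dist x c \<le> 2 * r" for x y
  proof -
    have "\<bar>f x\<bar> \<le> L * (2 * r)"
      using f_diff[of x c] fc mult_left_mono[OF x L] by simp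
    then have "\<bar>(bump c r x - bump c r y) * f x\<bar> \<le> (dist x y / r) * (L * (2 * r))"
      unfolding abs_mult using bump_diff_le[OF r, of c x y] r by (intro mult_mono) auto
    moreover have "\<bar>bump c r y * (f x - f y)\<bar> \<le> 1 * (L * dist x y)"
      unfolding abs_mult using bump_nonneg[of c r y] bump_le_1[of c r y] f_diff[of x y]
      by (intro mult_mono) auto
    moreover have "(dist x y / r) * (L * (2 * r)) = 2 * L * dist x y"
      using r by simp
    moreover have "bump c r x * f x - bump c r y * f y
        = (bump c r x - bump c r y) * f x + bump c r y * (f x - f y)"
      by (simp add: algebra_simps)
    ultimately show ?thesis
      by linarith
  qed
  fix x y
  consider "dist x c \<le> 2 * r" | "dist y c \<le> 2 * r" | "2 * r \<le> dist x c" "2 * r \<le> dist y c"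
    by linarith
  then show "dist (bump c r x * f x) (bump c r y * f y) \<le> 3 * L * dist x y"
  proof cases
    case 1
    then show ?thesis using near by (simp add: dist_real_def)
  next
    case 2
    then show ?thesis using near[of y x] by (simp add: dist_real_def dist_commute abs_minus_commute)
  next
    case 3
    then show ?thesis using r L by (simp add: bump_eq_0)
  qed
qed

text \<open>The glued function is the sum of all \<open>h n\<close>, since at most the term with
  index \<open>i x\<close> is nonzero at \<open>x\<close>. Comparing two points involves only their
  two indices, whence the factor 2.\<close>

lemma lipschitz_on_disjoint_supports:
  fixes h :: "'i \<Rightarrow> 'a::metric_space \<Rightarrow> real"
  assumes h: "\<And>n. L-lipschitz_on M (h n)"
    and supp: "\<And>n x. x \<in> M \<Longrightarrow> n \<noteq> i x \<Longrightarrow> h n x = 0"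
  shows "(2 * L)-lipschitz_on M (\<lambda>x. h (i x) x)"
proof (rule lipschitz_onI)
  show "0 \<le> 2 * L"
    using lipschitz_on_nonneg[OF h] by simp
  fix x y assume xy: "x \<in> M" "y \<in> M"
  have h_diff: "\<bar>h n x - h n y\<bar> \<le> L * dist x y" for n
    using lipschitz_onD[OF h xy, of n] by (simp add: dist_real_def)
  have "\<bar>h (i x) x - h (i y) y\<bar> \<le> \<bar>h (i x) x - h (i x) y\<bar> + \<bar>h (i y) x - h (i y) y\<bar>"
    using supp[OF xy(1), of "i y"] supp[OF xy(2), of "i x"] by (cases "i x = i y") auto
  then show "dist (h (i x) x) (h (i y) y) \<le> 2 * L * dist x y"
    using h_diff[of "i x"] h_diff[of "i y"] by (simp add: dist_real_def)
qed

text \<open>Multiplying the values by \<open>k\<close> compensates for dividing the increments of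
  the argument by \<open>k\<close>; the point \<open>c\<close> plays the role of
  \<open>q\<close>.\<close>

lemma lipschitz_on_dilation:
  fixes f :: "'a::real_normed_vector \<Rightarrow> real"
  assumes f: "L-lipschitz_on UNIV f" and k: "k > 0"
  shows "L-lipschitz_on UNIV (\<lambda>x. k * f (q + (x - c) /\<^sub>R k))"
proof (rule lipschitz_onI)
  fix x y
  have "dist (q + (x - c) /\<^sub>R k) (q + (y - c) /\<^sub>R k) = norm ((x - y) /\<^sub>R k)"
    by (simp add: dist_norm algebra_simps)
  also have "\<dots> = dist x y / k"
    using k by (simp add: dist_norm divide_inverse)
  finally have "k * dist (f (q + (x - c) /\<^sub>R k)) (f (q + (y - c) /\<^sub>R k)) \<le> k * (L * (dist x y / k))"
    using k lipschitz_onD[OF f, of "q + (x - c) /\<^sub>R k" "q + (y - c) /\<^sub>R k"]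
    by (intro mult_left_mono) auto
  then show "dist (k * f (q + (x - c) /\<^sub>R k)) (k * f (q + (y - c) /\<^sub>R k)) \<le> L * dist x y"
    using k by (simp add: dist_real_def abs_mult flip: right_diff_distrib)
qed (use f in \<open>rule lipschitz_on_nonneg\<close>)

section \<open>Complemented subspaces from left inverses\<close>

lemma bounded_linear_between_diff:
  assumes "bounded_linear_between V nV W nW T" "subspace V" "f \<in> V" "g \<in> V"
  shows "T (f - g) = T f - T g"
proof -
  have "- 1 *\<^sub>R g \<in> V"
    using assms by (intro subspace_scale)
  then have "T (f + (- 1) *\<^sub>R g) = T f + (- 1) *\<^sub>R T g"
    using assms unfolding bounded_linear_between_def by metis
  then show ?thesis
    by simp
qed

lemma bounded_linear_between_compose:
  assumes T: "bounded_linear_between V nV W nW T" and S: "bounded_linear_between W nW Z nZ S"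
    and nonneg: "\<And>g. g \<in> W \<Longrightarrow> 0 \<le> nW g"
  shows "bounded_linear_between V nV Z nZ (\<lambda>f. S (T f))"
proof -
  obtain K where K: "\<And>f. f \<in> V \<Longrightarrow> nW (T f) \<le> K * nV f"
    using T unfolding bounded_linear_between_def by blast
  obtain K' where K': "\<And>g. g \<in> W \<Longrightarrow> nZ (S g) \<le> K' * nW g"
    using S unfolding bounded_linear_between_def by blast
  have "nZ (S (T f)) \<le> (\<bar>K'\<bar> * K) * nV f" if f: "f \<in> V" for f
  proof -
    have TW: "T f \<in> W"
      using T f unfolding bounded_linear_between_def by blast
    have "nZ (S (T f)) \<le> K' * nW (T f)"
      using K'[OF TW] .
    \<comment> \<open>\<open>K'\<close> may be negative, so it is replaced by its absolute value
      before the bound for \<open>T\<close> is inserted.\<close>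
    also have "\<dots> \<le> \<bar>K'\<bar> * nW (T f)"
      using nonneg[OF TW] by (intro mult_right_mono) auto
    also have "\<dots> \<le> \<bar>K'\<bar> * (K * nV f)"
      using K[OF f] by (intro mult_left_mono) auto
    finally show ?thesis
      by (simp add: mult.assoc)
  qed
  then show ?thesis
    using T S unfolding bounded_linear_between_def by auto
qed

text \<open>\<open>T \<circ> S\<close> is idempotent because \<open>S \<circ> T\<close> is the
  identity, and its range is that of \<open>T\<close>, on which \<open>S\<close> inverts
  \<open>T\<close>. The range is closed as the set of fixed points of a bounded map.\<close>

lemma complemented_range_of_left_inverse:
  fixes V :: "'v::real_vector set" and N :: "'a::metric_space set"
  assumes V: "subspace V" and p: "p \<in> N"
    and T: "bounded_linear_between V nV (lip0 N p) (lip_norm N) T"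
    and S: "bounded_linear_between (lip0 N p) (lip_norm N) V nV S"
    and ST: "\<And>f. f \<in> V \<Longrightarrow> S (T f) = f"
    and nonneg: "\<And>f. f \<in> V \<Longrightarrow> 0 \<le> nV f"
  shows "complemented_subspace (T ` V) (lip0 N p) (lip_norm N) \<and>
    linearly_isomorphic V nV (T ` V) (lip_norm N)"
proof -
  let ?W = "lip0 N p"
  note W = subspace_lip0[of N p]
  have T_in: "T f \<in> ?W" and T_add: "g \<in> V \<Longrightarrow> T (f + g) = T f + T g"
    and T_scale: "T (c *\<^sub>R f) = c *\<^sub>R T f" if "f \<in> V" for f g c
    using T that unfolding bounded_linear_between_def by blast+
  have S_in: "S h \<in> V" if "h \<in> ?W" for h
    using S that unfolding bounded_linear_between_def by blast
  have TS: "T (S h) = h" if "h \<in> T ` V" for h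
    using that ST by auto
  have TV: "T ` V \<subseteq> ?W"
    using T_in by auto
  have subsp: "subspace (T ` V)"
  proof (rule subspaceI)
    have "T (0 *\<^sub>R 0) = 0 *\<^sub>R T 0"
      using V by (intro T_scale subspace_0)
    then have "T 0 = 0"
      by (simp only: scaleR_zero_left)
    then show "0 \<in> T ` V"
      using subspace_0[OF V] by force
    show "h + k \<in> T ` V" if hk: "h \<in> T ` V" "k \<in> T ` V" for h k
    proof -
      obtain f g where "f \<in> V" "g \<in> V" "h = T f" "k = T g"
        using hk by blast
      then show ?thesis
        using T_add[of f g] subspace_add[OF V, of f g] by (metis imageI)
    qed
    show "c *\<^sub>R h \<in> T ` V" if h: "h \<in> T ` V" for c h
    proof -
      obtain f where "f \<in> V" "h = T f"
        using h by blast
      then show ?thesis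
        using T_scale[of f c] subspace_scale[OF V, of f c] by (metis imageI)
    qed
  qed
  have P: "bounded_linear_between ?W (lip_norm N) ?W (lip_norm N) (\<lambda>h. T (S h))"
    using S T nonneg by (rule bounded_linear_between_compose)
  then obtain K where K: "\<And>h. h \<in> ?W \<Longrightarrow> lip_norm N (T (S h)) \<le> K * lip_norm N h"
    unfolding bounded_linear_between_def by blast
  have closed: "norm_closed_in (T ` V) ?W (lip_norm N)"
    unfolding norm_closed_in_def
  proof (intro allI impI, elim conjE)
    fix s f assume s: "\<forall>n. s n \<in> T ` V" and f: "f \<in> ?W"
      and lim: "(\<lambda>n. lip_norm N (s n - f)) \<longlonglongrightarrow> 0"
    have sW: "s n \<in> ?W" for n
      using s TV by auto
    have Pf: "T (S f) \<in> ?W"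
      using f S_in T_in by auto
    \<comment> \<open>With \<open>P = T \<circ> S\<close> and \<open>P (s n) = s n\<close>, the
      difference \<open>f - P f\<close> equals \<open>(f - s n) + P (s n - f)\<close>, and both
      terms tend to zero in norm.\<close>
    have "lip_norm N (f - T (S f)) \<le> (1 + K) * lip_norm N (s n - f)" for n
    proof -
      have d: "s n - f \<in> ?W" "f - s n \<in> ?W"
        using W f sW by (auto intro: subspace_diff)
      have Pd: "T (S (s n - f)) = s n - T (S f)"
        using bounded_linear_between_diff[OF P W sW f] s TS by simp
      have "lip_norm N (f - T (S f)) = lip_norm N ((f - s n) + (s n - T (S f)))"
        by simp
      also have "\<dots> \<le> lip_norm N (f - s n) + lip_norm N (s n - T (S f))"
        using d W sW Pf by (intro lip_norm_triangle[of _ N p]) (auto intro: subspace_diff)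
      also have "lip_norm N (f - s n) = lip_norm N (s n - f)"
        using lip_norm_scaleR[OF d(1), of "-1"] by simp
      also have "lip_norm N (s n - T (S f)) \<le> K * lip_norm N (s n - f)"
        using K[OF d(1)] Pd by simp
      finally show ?thesis
        by (simp only: distrib_right mult_1_left)
    qed
    moreover have "(\<lambda>n. (1 + K) * lip_norm N (s n - f)) \<longlonglongrightarrow> 0"
      using tendsto_mult_left[OF lim, of "1 + K"] by simp
    ultimately have "lip_norm N (f - T (S f)) \<le> 0"
      by (intro LIMSEQ_le_const) auto
    moreover have fP: "f - T (S f) \<in> ?W"
      using W f Pf by (rule subspace_diff)
    ultimately have "f - T (S f) = 0"
      using lip_norm_nonneg[OF fP] lip_norm_eq_0_iff[OF fP p] by simp
    then show "f \<in> T ` V"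
      using S_in[OF f] by (simp add: image_iff) metis
  qed
  have range: "(\<lambda>h. T (S h)) ` ?W = T ` V"
  proof
    show "(\<lambda>h. T (S h)) ` ?W \<subseteq> T ` V"
      using S_in by auto
    show "T ` V \<subseteq> (\<lambda>h. T (S h)) ` ?W"
      using TS TV by force
  qed
  have compl: "complemented_subspace (T ` V) ?W (lip_norm N)"
    unfolding complemented_subspace_def using subsp TV closed P range TS by blast
  have inj: "inj_on T V"
    by (rule inj_on_inverseI[of _ S]) (rule ST)
  have inv: "inv_into V T h = S h" if "h \<in> T ` V" for h
    using that inj ST inv_into_f_f[OF inj] by fastforce
  have "bounded_linear_between V nV (T ` V) (lip_norm N) T"
    using T unfolding bounded_linear_between_def by auto
  moreover have "bounded_linear_between (T ` V) (lip_norm N) V nV (inv_into V T)"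
    using S TV unfolding bounded_linear_between_def Ball_def
    by (simp only: inv subspace_add[OF subsp] subspace_scale[OF subsp] simp_thms cong: imp_cong) blast
  ultimately have "linearly_isomorphic V nV (T ` V) (lip_norm N)"
    unfolding linearly_isomorphic_def using inj by (auto simp: bij_betw_def)
  with compl show ?thesis
    by blast
qed

section \<open>Transplanting at growing scales and blowing down\<close>

definition centre :: "'a::real_normed_vector \<Rightarrow> nat \<Rightarrow> 'a" where
  "centre e n = (4 * 4 ^ n) *\<^sub>R e"

text \<open>Outside all the balls the choice is arbitrary, which is harmless: every cutoff vanishes
  there.\<close>

definition ball_index :: "'a::real_normed_vector \<Rightarrow> 'a \<Rightarrow> nat" where
  "ball_index e x = (SOME n. dist x (centre e n) < 2 * 4 ^ n)"

definition transplant ::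
  "'a::real_normed_vector \<Rightarrow> 'a \<Rightarrow> ('a \<Rightarrow> real) \<Rightarrow> nat \<Rightarrow> 'a \<Rightarrow> real" where
  "transplant e q f n x =
     bump (centre e n) (4 ^ n) x * (2 ^ n * f (q + (x - centre e n) /\<^sub>R 2 ^ n))"

text \<open>The term with index \<open>ball_index e x\<close> stands for the whole sum over
  \<open>n\<close>. Subtracting the value at \<open>p\<close> restores the base point condition, and
  the zero extension is the one demanded by \<open>lip0\<close>.\<close>

definition spread ::
  "'a::real_normed_vector set \<Rightarrow> 'a \<Rightarrow> 'a \<Rightarrow> 'a \<Rightarrow> ('a \<Rightarrow> real) \<Rightarrow> 'a \<Rightarrow> real" where
  "spread N p e q f x = (if x \<in> N
     then transplant e q f (ball_index e x) x - transplant e q f (ball_index e p) p else 0)"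

text \<open>Inverse of the rescaling inside \<open>transplant\<close>, followed by rounding to the
  net through \<open>\<pi>\<close>.\<close>

definition sample ::
  "('a::real_normed_vector \<Rightarrow> 'a) \<Rightarrow> 'a \<Rightarrow> 'a \<Rightarrow> nat \<Rightarrow> 'a \<Rightarrow> 'a" where
  "sample \<pi> e q n x = \<pi> (centre e n + 2 ^ n *\<^sub>R (x - q))"

text \<open>Subtracting the value at the sample of \<open>q\<close> keeps the quotients bounded and
  makes the limit vanish at \<open>q\<close>.\<close>

definition blow_down ::
  "nat filter \<Rightarrow> ('a::real_normed_vector \<Rightarrow> 'a) \<Rightarrow> 'a \<Rightarrow> 'a \<Rightarrow> ('a \<Rightarrow> real) \<Rightarrow> 'a \<Rightarrow> real" where
  "blow_down U \<pi> e q g x = Lim U (\<lambda>n. (g (sample \<pi> e q n x) - g (sample \<pi> e q n q)) / 2 ^ n)"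

section \<open>Disjoint balls and the spreading operator\<close>

lemma dist_centre:
  assumes "norm e = 1" "m < n"
  shows "2 * 4 ^ m + 2 * 4 ^ n \<le> dist (centre e m) (centre e n)"
proof -
  \<comment> \<open>The centres are \<open>4 * 4 ^ n - 4 * 4 ^ m\<close> apart, and
    \<open>4 ^ n\<close> is at least \<open>4 * 4 ^ m\<close>.\<close>
  have "(4::real) ^ Suc m \<le> 4 ^ n"
    using assms(2) by (intro power_increasing) auto
  moreover have "dist (centre e m) (centre e n) = \<bar>4 * 4 ^ m - 4 * 4 ^ n\<bar>"
    using assms(1) unfolding centre_def dist_norm by (simp flip: scaleR_diff_left)
  ultimately show ?thesis
    by simp
qed

lemma ball_index_eqI:
  assumes e: "norm e = 1" and n: "dist x (centre e n) < 2 * 4 ^ n"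
  shows "ball_index e x = n"
proof -
  have False if mn: "m < n" "dist x (centre e m) < 2 * 4 ^ m" "dist x (centre e n) < 2 * 4 ^ n" for m n
    using dist_centre[OF e mn(1)] dist_triangle3[of "centre e m" "centre e n" x] mn by linarith
  then have "m = n" if "dist x (centre e m) < 2 * 4 ^ m" for m
    using n that by (cases m n rule: linorder_cases) blast+
  then show ?thesis
    unfolding ball_index_def using n by (rule some_equality[rotated])
qed

lemma transplant_add: "transplant e q (f + g) n x = transplant e q f n x + transplant e q g n x"
  by (simp add: transplant_def distrib_left)

lemma transplant_scaleR: "transplant e q (c *\<^sub>R f) n x = c * transplant e q f n x"
  by (simp add: transplant_def)

lemma transplant_eq_0:
  assumes "norm e = 1" "n \<noteq> ball_index e x"
  shows "transplant e q f n x = 0"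
proof -
  have "2 * 4 ^ n \<le> dist x (centre e n)"
    using ball_index_eqI[OF assms(1), of x n] assms(2) by fastforce
  then show ?thesis
    by (simp add: transplant_def bump_eq_0)
qed

lemma lipschitz_on_transplant:
  assumes "L-lipschitz_on UNIV f" "f q = 0"
  shows "(3 * L)-lipschitz_on UNIV (transplant e q f n)"
  unfolding transplant_def
proof (rule lipschitz_on_bump_mult)
  show "L-lipschitz_on UNIV (\<lambda>x. 2 ^ n * f (q + (x - centre e n) /\<^sub>R 2 ^ n))"
    using assms(1) by (rule lipschitz_on_dilation) simp
qed (use assms(2) in simp_all)

lemma lipschitz_on_spread:
  assumes e: "norm e = 1" and f: "L-lipschitz_on UNIV f" "f q = 0"
  shows "(6 * L)-lipschitz_on N (spread N p e q f)"
proof -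
  \<comment> \<open>The factor 3 is the price of the cutoff, 2 that of the gluing; the constant
    subtracted in \<open>spread\<close> costs nothing.\<close>
  have "(2 * (3 * L))-lipschitz_on N (\<lambda>x. transplant e q f (ball_index e x) x)"
  proof (rule lipschitz_on_disjoint_supports[where i = "ball_index e"])
    show "(3 * L)-lipschitz_on N (transplant e q f n)" for n
      using lipschitz_on_transplant[OF f] subset_UNIV by (rule lipschitz_on_subset)
    show "transplant e q f n x = 0" if "x \<in> N" "n \<noteq> ball_index e x" for n x
      using e that(2) by (rule transplant_eq_0)
  qed
  then show ?thesis
    by (simp add: lipschitz_on_def spread_def dist_real_def)
qed

lemma bounded_linear_between_spread:
  assumes e: "norm e = 1" and p: "p \<in> N"
  shows "bounded_linear_between (lip0 UNIV q) (lip_norm UNIV) (lip0 N p) (lip_norm N)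
    (spread N p e q)"
proof -
  have lip: "(6 * lip_norm UNIV f)-lipschitz_on N (spread N p e q f)" if "f \<in> lip0 UNIV q" for f
    using e that by (intro lipschitz_on_spread lip_norm_lipschitz) (auto simp: lip0_def)
  have "spread N p e q f \<in> lip0 N p" if "f \<in> lip0 UNIV q" for f
    using lip[OF that] p by (auto simp: lip0_def spread_def)
  moreover have "spread N p e q (f + g) = spread N p e q f + spread N p e q g" for f g
    by (simp add: fun_eq_iff spread_def transplant_add)
  moreover have "spread N p e q (c *\<^sub>R f) = c *\<^sub>R spread N p e q f" for c f
    by (simp add: fun_eq_iff spread_def transplant_scaleR right_diff_distrib)
  moreover have "lip_norm N (spread N p e q f) \<le> 6 * lip_norm UNIV f" if "f \<in> lip0 UNIV q" for f
    using lip[OF that] by (rule lip_norm_le)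
  ultimately show ?thesis
    unfolding bounded_linear_between_def by blast
qed

section \<open>The blow-down operator along an ultrafilter\<close>

lemma mesh_tendsto_0: "(\<lambda>n. C / 2 ^ n :: real) \<longlonglongrightarrow> 0"
  using tendsto_mult_left[OF LIMSEQ_power_zero[of "1 / 2 :: real"], of C]
  by (simp add: power_divide)

text \<open>Rounding to the net moves each of the two points by at most \<open>\<epsilon>\<close>,
  and at scale \<open>2 ^ n\<close> this error fades. So the constant \<open>L\<close> survives in
  the limit without loss.\<close>

lemma sample_quotient_le:
  assumes \<pi>: "\<And>x. \<pi> x \<in> N" "\<And>x. dist x (\<pi> x) \<le> \<epsilon>" and g: "L-lipschitz_on N g"
  shows "\<bar>(g (sample \<pi> e q n x) - g (sample \<pi> e q n y)) / 2 ^ n\<bar> \<le> L * dist x y + 2 * L * \<epsilon> / 2 ^ n"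
proof -
  let ?u = "\<lambda>x. centre e n + 2 ^ n *\<^sub>R (x - q)"
  have "dist (?u x) (?u y) = norm ((2 ^ n) *\<^sub>R (x - y))"
    by (simp add: dist_norm algebra_simps)
  then have "dist (?u x) (?u y) = 2 ^ n * dist x y"
    by (simp add: dist_norm)
  then have "dist (\<pi> (?u x)) (\<pi> (?u y)) \<le> 2 ^ n * dist x y + 2 * \<epsilon>"
    using \<pi>(2)[of "?u x"] \<pi>(2)[of "?u y"] dist_triangle3[of "\<pi> (?u x)" "\<pi> (?u y)" "?u x"]
      dist_triangle[of "?u x" "\<pi> (?u y)" "?u y"] by linarith
  then have "L * dist (\<pi> (?u x)) (\<pi> (?u y)) \<le> L * (2 ^ n * dist x y + 2 * \<epsilon>)"
    using lipschitz_on_nonneg[OF g] by (rule mult_left_mono)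
  then have "\<bar>g (sample \<pi> e q n x) - g (sample \<pi> e q n y)\<bar> \<le> L * (2 ^ n * dist x y + 2 * \<epsilon>)"
    using lipschitz_onD[OF g \<pi>(1) \<pi>(1), of "?u x" "?u y"] by (simp add: sample_def dist_real_def)
  then show ?thesis
    by (simp add: field_simps)
qed

lemma blow_down_tendsto:
  assumes U: "ultrafilter U" and \<pi>: "\<And>x. \<pi> x \<in> N" "\<And>x. dist x (\<pi> x) \<le> \<epsilon>"
    and g: "L-lipschitz_on N g"
  shows "((\<lambda>n. (g (sample \<pi> e q n x) - g (sample \<pi> e q n q)) / 2 ^ n) \<longlongrightarrow> blow_down U \<pi> e q g x) U"
  unfolding blow_down_def
proof (rule ultrafilter_Lim_bounded[OF U])
  fix n
  have "0 \<le> \<epsilon>"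
    using \<pi>(2)[of q] zero_le_dist[of q "\<pi> q"] by linarith
  \<comment> \<open>Since \<open>2 ^ n\<close> is at least 1, the bound becomes independent of
    \<open>n\<close>, as the existence of the ultralimit requires.\<close>
  then have "2 * L * \<epsilon> / 2 ^ n \<le> 2 * L * \<epsilon>"
    using lipschitz_on_nonneg[OF g] mult_left_mono[of 1 "2 ^ n" "2 * L * \<epsilon>"]
    by (simp add: divide_le_eq)
  then show "\<bar>(g (sample \<pi> e q n x) - g (sample \<pi> e q n q)) / 2 ^ n\<bar> \<le> L * dist x q + 2 * L * \<epsilon>"
    using sample_quotient_le[OF \<pi> g, of e q n x q] by linarith
qed

lemma bounded_linear_between_blow_down:
  assumes U: "ultrafilter U" "U \<le> sequentially"
    and \<pi>: "\<And>x. \<pi> x \<in> N" "\<And>x. dist x (\<pi> x) \<le> \<epsilon>"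
  shows "bounded_linear_between (lip0 N p) (lip_norm N) (lip0 UNIV q) (lip_norm UNIV)
    (blow_down U \<pi> e q)"
proof -
  have nb: "U \<noteq> bot"
    using U(1) by (simp add: ultrafilter_def)
  note lim = blow_down_tendsto[OF U(1) \<pi> lip_norm_lipschitz[where p = p], of _ e q]
  have lip: "(lip_norm N g)-lipschitz_on UNIV (blow_down U \<pi> e q g)" if g: "g \<in> lip0 N p" for g
  proof (rule lipschitz_onI)
    fix x y
    let ?L = "lip_norm N g"
    \<comment> \<open>The values at the sample of \<open>q\<close> cancel in this difference, which
      leaves the quotient estimated in \<open>sample_quotient_le\<close>.\<close>
    have "((\<lambda>n. \<bar>(g (sample \<pi> e q n x) - g (sample \<pi> e q n q)) / 2 ^ n
        - (g (sample \<pi> e q n y) - g (sample \<pi> e q n q)) / 2 ^ n\<bar>)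
        \<longlongrightarrow> \<bar>blow_down U \<pi> e q g x - blow_down U \<pi> e q g y\<bar>) U"
      by (intro tendsto_intros lim g)
    moreover have "((\<lambda>n. ?L * dist x y + 2 * ?L * \<epsilon> / 2 ^ n) \<longlongrightarrow> ?L * dist x y + 0) U"
      by (intro tendsto_intros tendsto_mono[OF U(2)] mesh_tendsto_0)
    ultimately show "dist (blow_down U \<pi> e q g x) (blow_down U \<pi> e q g y) \<le> ?L * dist x y"
      using tendsto_le[OF nb] sample_quotient_le[OF \<pi> lip_norm_lipschitz[OF g], of e q _ x y]
      by (force simp: dist_real_def simp flip: diff_divide_distrib)
  qed (use g in \<open>rule lip_norm_nonneg\<close>)
  have "blow_down U \<pi> e q g q = 0" for g
    using tendsto_Lim[OF nb tendsto_const, of 0] by (simp add: blow_down_def)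
  then have "blow_down U \<pi> e q g \<in> lip0 UNIV q" if "g \<in> lip0 N p" for g
    using lip[OF that] by (auto simp: lip0_def)
  moreover have "blow_down U \<pi> e q (f + g) = blow_down U \<pi> e q f + blow_down U \<pi> e q g"
    if "f \<in> lip0 N p" "g \<in> lip0 N p" for f g
  proof
    fix x
    show "blow_down U \<pi> e q (f + g) x = (blow_down U \<pi> e q f + blow_down U \<pi> e q g) x"
      unfolding blow_down_def[of _ _ _ _ "f + g"]
      using tendsto_add[OF lim[OF that(1), of x] lim[OF that(2), of x]]
      by (intro tendsto_Lim[OF nb]) (simp add: add_divide_distrib diff_divide_distrib algebra_simps)
  qed
  moreover have "blow_down U \<pi> e q (c *\<^sub>R g) = c *\<^sub>R blow_down U \<pi> e q g"
    if "g \<in> lip0 N p" for c g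
  proof
    fix x
    show "blow_down U \<pi> e q (c *\<^sub>R g) x = (c *\<^sub>R blow_down U \<pi> e q g) x"
      unfolding blow_down_def[of _ _ _ _ "c *\<^sub>R g"]
      using tendsto_mult_left[OF lim[OF that, of x], of c]
      by (intro tendsto_Lim[OF nb]) (simp add: right_diff_distrib)
  qed
  moreover have "lip_norm UNIV (blow_down U \<pi> e q g) \<le> 1 * lip_norm N g" if "g \<in> lip0 N p" for g
    using lip[OF that] by (auto intro: lip_norm_le)
  ultimately show ?thesis
    unfolding bounded_linear_between_def by blast
qed

section \<open>Blowing down undoes spreading\<close>

lemma dist_sample_rescaled:
  assumes \<pi>: "\<And>x. dist x (\<pi> x) \<le> \<epsilon>"
  shows "dist (q + (sample \<pi> e q n x - centre e n) /\<^sub>R 2 ^ n) x \<le> \<epsilon> / 2 ^ n"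
proof -
  let ?u = "centre e n + 2 ^ n *\<^sub>R (x - q)"
  have "q + (\<pi> ?u - centre e n) /\<^sub>R 2 ^ n - x = (\<pi> ?u - ?u) /\<^sub>R 2 ^ n"
    by (simp add: algebra_simps)
  then have "dist (q + (sample \<pi> e q n x - centre e n) /\<^sub>R 2 ^ n) x = dist ?u (\<pi> ?u) / 2 ^ n"
    by (simp add: sample_def dist_norm divide_inverse norm_minus_commute)
  then show ?thesis
    using \<pi>[of ?u] by (simp add: divide_right_mono)
qed

text \<open>The sample is at distance at most \<open>2 ^ n * (norm (x - q) + \<epsilon>)\<close>
  from the centre. Once \<open>2 ^ n\<close> dominates the bracket, this is below
  \<open>4 ^ n\<close>, the radius within which the cutoff equals 1.\<close>

lemma eventually_sample_near_centre:
  assumes \<pi>: "\<And>x. dist x (\<pi> x) \<le> \<epsilon>"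
  shows "\<forall>\<^sub>F n in sequentially. dist (sample \<pi> e q n x) (centre e n) \<le> 4 ^ n"
proof -
  have "\<forall>\<^sub>F n in sequentially. norm (x - q) + \<epsilon> \<le> 2 ^ n"
    using order_tendstoD(2)[OF mesh_tendsto_0[of "norm (x - q) + \<epsilon>"], of 1]
    by (auto elim!: eventually_mono simp: field_simps)
  then show ?thesis
  proof eventually_elim
    case (elim n)
    let ?u = "centre e n + 2 ^ n *\<^sub>R (x - q)"
    have "0 \<le> \<epsilon>"
      using \<pi>[of q] zero_le_dist[of q "\<pi> q"] by linarith
    then have "\<epsilon> \<le> 2 ^ n * \<epsilon>"
      using mult_right_mono[of 1 "2 ^ n" \<epsilon>] by simp
    moreover have "dist ?u (centre e n) = 2 ^ n * norm (x - q)"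
      by (simp add: dist_norm)
    ultimately have "dist (\<pi> ?u) (centre e n) \<le> 2 ^ n * (norm (x - q) + \<epsilon>)"
      using \<pi>[of ?u] dist_triangle3[of "\<pi> ?u" "centre e n" ?u] by (simp add: algebra_simps)
    also have "\<dots> \<le> 2 ^ n * 2 ^ n"
      using elim by simp
    also have "\<dots> = 4 ^ n"
      by (simp flip: power_mult_distrib)
    finally show ?case
      by (simp add: sample_def)
  qed
qed

lemma blow_down_spread:
  assumes U: "ultrafilter U" "U \<le> sequentially"
    and \<pi>: "\<And>x. \<pi> x \<in> N" "\<And>x. dist x (\<pi> x) \<le> \<epsilon>"
    and e: "norm e = 1" and f: "f \<in> lip0 UNIV q"
  shows "blow_down U \<pi> e q (spread N p e q f) = f"
proof
  fix x
  let ?v = "\<lambda>n x. f (q + (sample \<pi> e q n x - centre e n) /\<^sub>R 2 ^ n)"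
  let ?g = "spread N p e q f"
  have cont: "isCont f y" for y
    using lipschitz_on_continuous_on[OF lip_norm_lipschitz[OF f]] by (simp add: continuous_on_eq_continuous_at)
  \<comment> \<open>The rescaled samples are within \<open>\<epsilon> / 2 ^ n\<close> of
    \<open>y\<close>, so continuity of \<open>f\<close> suffices.\<close>
  have v: "(\<lambda>n. ?v n y) \<longlonglongrightarrow> f y" for y
  proof (rule isCont_tendsto_compose[OF cont])
    show "(\<lambda>n. q + (sample \<pi> e q n y - centre e n) /\<^sub>R 2 ^ n) \<longlonglongrightarrow> y"
      unfolding tendsto_dist_iff[of _ y]
      using dist_sample_rescaled[of \<pi>, OF \<pi>(2)]
      by (intro tendsto_sandwich[OF _ _ tendsto_const mesh_tendsto_0[of \<epsilon>]]) auto
  qed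
  have g: "\<forall>\<^sub>F n in sequentially. ?g (sample \<pi> e q n y)
      = 2 ^ n * ?v n y - transplant e q f (ball_index e p) p" for y
    using eventually_sample_near_centre[of \<pi>, OF \<pi>(2), of e q y]
  proof eventually_elim
    case (elim n)
    have "(4::real) ^ n < 2 * 4 ^ n"
      by simp
    then have "ball_index e (sample \<pi> e q n y) = n"
      using elim by (intro ball_index_eqI[OF e]) linarith
    then show ?case
      using elim \<pi>(1) by (simp add: spread_def transplant_def bump_eq_1 sample_def)
  qed
  \<comment> \<open>The normalising constant of \<open>spread\<close> is the same at both samples
    and cancels, as does the factor \<open>2 ^ n\<close>.\<close>
  have "\<forall>\<^sub>F n in sequentially.
      ?v n x - ?v n q = (?g (sample \<pi> e q n x) - ?g (sample \<pi> e q n q)) / 2 ^ n"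
    using g[of x] g[of q] by eventually_elim (simp add: field_simps)
  moreover have "(\<lambda>n. ?v n x - ?v n q) \<longlonglongrightarrow> f x"
    using tendsto_diff[OF v[of x] v[of q]] f by (simp add: lip0_def)
  ultimately have "(\<lambda>n. (?g (sample \<pi> e q n x) - ?g (sample \<pi> e q n q)) / 2 ^ n) \<longlonglongrightarrow> f x"
    by (rule Lim_transform_eventually[rotated])
  then show "blow_down U \<pi> e q ?g x = f x"
    \<comment> \<open>For functions in the range of \<open>spread\<close> the limit exists along the
      whole sequence, hence along the finer \<open>U\<close> with the same value.\<close>
    unfolding blow_down_def using U
    by (intro tendsto_Lim) (auto simp: ultrafilter_def intro: tendsto_mono)
qed

section \<open>Conclusion, with the zero space treated separately\<close>

theorem theorem3p7:
  fixes N :: "'a::banach set" and p q :: 'a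
  assumes "metric_net N UNIV" and "p \<in> N"
  shows "\<exists>Y. complemented_subspace Y (lip0 N p) (lip_norm N) \<and>
             linearly_isomorphic (lip0 UNIV q) (lip_norm UNIV) Y (lip_norm N)"
proof (cases "\<exists>v::'a. v \<noteq> 0")
  case True
  then obtain e :: 'a where e: "norm e = 1"
    using norm_sgn by metis
  obtain \<epsilon> where "\<forall>x. \<exists>y\<in>N. dist x y \<le> \<epsilon>"
    using assms(1) unfolding metric_net_def by auto
  then obtain \<pi> where \<pi>: "\<And>x. \<pi> x \<in> N" "\<And>x. dist x (\<pi> x) \<le> \<epsilon>"
    by metis
  obtain U where U: "U \<le> sequentially" "ultrafilter U"
    using ultrafilter_exists[OF sequentially_bot] by blast
  show ?thesis
    \<comment> \<open>The witness \<open>Y\<close> is the range of \<open>spread N p e q\<close>,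
      with \<open>blow_down U \<pi> e q\<close> as left inverse.\<close>
    by (intro exI, rule complemented_range_of_left_inverse[OF subspace_lip0 assms(2)
          bounded_linear_between_spread[OF e assms(2)]
          bounded_linear_between_blow_down[OF U(2,1) \<pi>, where e = e]])
      (simp_all add: blow_down_spread[OF U(2,1) \<pi> e] lip_norm_nonneg)
next
  \<comment> \<open>There is no unit vector here, but \<open>lip0 UNIV q\<close> is then trivial and
    zero maps serve as \<open>T\<close> and \<open>S\<close>.\<close>
  case False
  then have q: "x = q" for x :: 'a
    using right_minus_eq[of x q] by blast
  have zero: "f = 0" if f: "f \<in> lip0 UNIV q" for f
  proof
    fix x
    have "f q = 0"
      using f by (simp add: lip0_def)
    then show "f x = 0 x"
      unfolding q[of x] by simp
  qed
  have 0: "0 \<in> lip0 N p" "0 \<in> lip0 UNIV q"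
    by (simp_all add: subspace_lip0 subspace_0)
  have norm_0: "lip_norm N 0 = 0" "lip_norm UNIV (0 :: 'a \<Rightarrow> real) = 0"
    using lip_norm_eq_0_iff[OF 0(1) assms(2)] lip_norm_eq_0_iff[OF 0(2) UNIV_I] by blast+
  have T: "bounded_linear_between (lip0 UNIV q) (lip_norm UNIV) (lip0 N p) (lip_norm N) (\<lambda>_. 0)"
    unfolding bounded_linear_between_def using 0 norm_0 by (simp add: exI[of _ 0])
  have S: "bounded_linear_between (lip0 N p) (lip_norm N) (lip0 UNIV q) (lip_norm UNIV) (\<lambda>_. 0)"
    unfolding bounded_linear_between_def using 0 norm_0 by (simp add: exI[of _ 0])
  show ?thesis
    by (intro exI, rule complemented_range_of_left_inverse[OF subspace_lip0 assms(2) T S])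
      (use zero in \<open>blast intro: lip_norm_nonneg sym\<close>)+
qed

end
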